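(* Consider the single-input discrete-time system $$x(t+1)=Ax(t)+Bu(t)+d(t)Gx(t),\qquad x(t)\in\mathbb{R}^n,\ u(t)\in\mathbb{R},\ d(t)\in D=[-a,a]\subseteq\mathbb{R},$$ where $A,G\in\mathbb{R}^{n\times n}$ are constant matrices, $a\ge0$ is a constant and $B\in\mathbb{R}^n$ is a constant vector. Suppose that there is a vector $k\in\mathbb{R}^n$, a constant $\lambda\in[0,1)$ and a symmetric positive definite matrix $P\in\mathbb{R}^{n\times n}$ such that $$x'(A+Bk')'P(A+Bk')x\le\lambda x'Px\quad\text{for all }x\in\mathbb{R}^n .$$ Let $r\ge2$ be a positive integer, and let $c>1$, $\varphi>0$, $\sigma\in[0,1)$ be constants. Define, for $(x,y_1,\dots,y_r)\in\mathbb{R}^n\times\mathbb{R}^r$: $$p:=c^r(B'PB+\varphi),\qquad L(x):=c^r(B'PA-\varphi k')A^{r-1}Gx,$$ $$\kappa(x,y_1,\dots,y_r):=(Ax+By_1)'PGx+\sum_{i=1}^{r-1}c^iy_{i+1}(B'PA-\varphi k')A^{i-1}Gx+\sum_{i=1}^{r}c^i\Big(A^ix+\sum_{j=1}^{i}A^{i-j}By_j\Big)'(A'PA+\varphi kk')A^{i-1}Gx,$$ $$b(x,y_1,\dots,y_r):=c^r(B'PA-\varphi k')\Big(A^rx+\sum_{j=1}^{r}A^{r-j}By_j\Big),$$ $$\begin{aligned}c(x,y_1,\dots,y_r):={}&a^2\sum_{i=0}^{r}c^i\,x'G'(A^i)'P(A^i)Gx+a^2\varphi\sum_{i=1}^{r}c^i\big(k'A^{i-1}Gx\big)^2\\&+(1-\sigma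 c)\sum_{i=1}^{r}c^{i-1}\Big(A^ix+\sum_{j=1}^{i}A^{i-j}By_j\Big)'P\Big(A^ix+\sum_{j=1}^{i}A^{i-j}By_j\Big)\\&+c^r\Big(A^rx+\sum_{j=1}^{r}A^{r-j}By_j\Big)'(A'PA+\varphi kk')\Big(A^rx+\sum_{j=1}^{r}A^{r-j}By_j\Big)\\&+(1-\sigma c)\varphi\sum_{i=2}^{r}c^{i-1}\Big(y_i-k'A^{i-1}x-k'\sum_{j=1}^{i-1}A^{i-1-j}By_j\Big)^2-\sigma x'Px-\sigma c\varphi(y_1-k'x)^2 .\end{aligned}$$ Consider the continuous, homogeneous of degree 1, function $K:\mathbb{R}^n\times\mathbb{R}^r\to\mathbb{R}$ defined (suppressing the arguments $(x,y_1,\dots,y_r)$ of $\kappa$ and $b$) by $$K(x,y_1,\dots,y_r):=\begin{cases}-L^{-1}(x)\,\kappa & \text{if } |p\kappa-bL(x)|<aL^2(x),\\ -p^{-1}(aL(x)+b) & \text{if } p\kappa-bL(x)\ge aL^2(x),\\ p^{-1}(aL(x)-b) & \text{if } p\kappa-bL(x)\le -aL^2(x).\end{cases}$$ Suppose that the following inequalities hold: (1) $p\left(\dfrac{\kappa(x,y_1,\dots,y_r)}{L(x)}\right)^2-2b(x,y_1,\dots,y_r)\dfrac{\kappa(x,y_1,\dots,y_r)}{L(x)}+c(x,y_1,\dots,y_r)\le0$ for all $(x,y_1,\dots,y_r)\in\mathbb{R}^n\times\mathbb{R}^r$ with $|p\kappa(x,y_1,\dots,y_r)-b(x,y_1,\dots,y_r)L(x)|<aL^2(x)$;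 (2) $-p^{-1}\big(aL(x)+b(x,y_1,\dots,y_r)\big)^2+c(x,y_1,\dots,y_r)+2a\kappa(x,y_1,\dots,y_r)\le0$ for all $(x,y_1,\dots,y_r)\in\mathbb{R}^n\times\mathbb{R}^r$ with $p\kappa(x,y_1,\dots,y_r)-b(x,y_1,\dots,y_r)L(x)\ge aL^2(x)$; (3) $-p^{-1}\big(aL(x)-b(x,y_1,\dots,y_r)\big)^2+c(x,y_1,\dots,y_r)-2a\kappa(x,y_1,\dots,y_r)\le0$ for all $(x,y_1,\dots,y_r)\in\mathbb{R}^n\times\mathbb{R}^r$ with $p\kappa(x,y_1,\dots,y_r)-b(x,y_1,\dots,y_r)L(x)\le-aL^2(x)$. Then $0\in\mathbb{R}^n\times\mathbb{R}^r$ is robustly globally exponentially stable for the closed-loop system $$x(t+1)=Ax(t)+By_1(t)+d(t)Gx(t),\qquad y_i(t+1)=y_{i+1}(t)\ (i=1,\dots,r),$$ $$x(t)\in\mathbb{R}^n,\quad y_i(t)\in\mathbb{R}\ (i=1,\dots,r),\quad d(t)\in D=[-a,a],$$ with $y_{r+1}(t)=u(t)=K(x(t),y_1(t),\dots,y_r(t))$.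
   Context: The prime $'$ denotes transposition of matrices and (column) vectors. The symbol $c$ alone (or with an exponent, $c^i$) denotes the constant $c>1$, while $c(x,y_1,\dots,y_r)$ with arguments denotes the function defined in the statement. $L^2(x)=(L(x))^2$ and $L^{-1}(x)=1/L(x)$. Robust global exponential stability is understood in the standard sense: for a system $z(t+1)=g(d(t),z(t))$, $t=0,1,2,\dots$, with $d(t)\in D$ an unknown time-varying parameter and $g(d,0)=0$ for all $d\in D$, the equilibrium $0$ is robustly globally exponentially stable if there exist constants $M,\omega>0$ such that for every initial condition $z(0)$ and every sequence $\{d(t)\in D\}_{t=0}^\infty$ the solution satisfies $|z(t)|\le M e^{-\omega t}|z(0)|$ for all integers $t\ge0$, where $|\cdot|$ is the Euclidean norm. *)

theory Defs
  imports "HOL-Analysis.Analysis"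
begin

(* Robust global exponential stability of the equilibrium 0 of z(t+1) = g(d(t), z(t)),
   d(t) \<in> D.  The state ranges over a Euclidean space, so norm is the Euclidean norm
   (on a product type: sqrt ((norm x)\<^sup>2 + (norm y)\<^sup>2)). *)
definition robustly_globally_exp_stable ::
    "'d set \<Rightarrow> ('d \<Rightarrow> 'z::euclidean_space \<Rightarrow> 'z) \<Rightarrow> bool" where
  "robustly_globally_exp_stable D g \<longleftrightarrow>
     (\<forall>d\<in>D. g d 0 = 0) \<and>
     (\<exists>M>0. \<exists>\<omega>>0. \<forall>(d :: nat \<Rightarrow> 'd) (z :: nat \<Rightarrow> 'z).
        (\<forall>t. d t \<in> D) \<longrightarrow> (\<forall>t. z (Suc t) = g (d t) (z t)) \<longrightarrow>
        (\<forall>t. norm (z t) \<le> M * exp (- \<omega> * real t) * norm (z 0)))"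

(* The class power (^) on real^'n^'n is the componentwise one. *)
definition mat_pow :: "real^'n^'n \<Rightarrow> nat \<Rightarrow> real^'n^'n" where
  "mat_pow A i = (((**) A) ^^ i) (mat 1)"

(* u v' *)
definition outer :: "real^'n \<Rightarrow> real^'n \<Rightarrow> real^'n^'n" where
  "outer u v = (\<chi> i j. u $ i * v $ j)"

(* w' P w *)
definition quad :: "real^'n^'n \<Rightarrow> real^'n \<Rightarrow> real" where
  "quad P w = w \<bullet> (P *v w)"

definition pos_def_sym :: "real^'n^'n \<Rightarrow> bool" where
  "pos_def_sym P \<longleftrightarrow> transpose P = P \<and> (\<forall>w. w \<noteq> 0 \<longrightarrow> 0 < quad P w)"

(* In the functions below, (y_1, ..., y_r) is passed as a function y :: nat \<Rightarrow> real, of which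
   only the values y 1, ..., y r are used. *)

(* A^i x + (\<Sum>j=1..i. A^(i-j) B y_j) *)
definition predictor ::
    "real^'n^'n \<Rightarrow> real^'n \<Rightarrow> real^'n \<Rightarrow> (nat \<Rightarrow> real) \<Rightarrow> nat \<Rightarrow> real^'n" where
  "predictor A B x y i =
     mat_pow A i *v x + (\<Sum>j=1..i. y j *\<^sub>R (mat_pow A (i - j) *v B))"

(* the row vector B'PA - \<phi> k' *)
definition row_vec ::
    "real^'n^'n \<Rightarrow> real^'n \<Rightarrow> real^'n^'n \<Rightarrow> real^'n \<Rightarrow> real \<Rightarrow> real^'n" where
  "row_vec A B P k \<phi> = B v* (P ** A) - \<phi> *\<^sub>R k"

(* the matrix A'PA + \<phi> k k' *)
definition weight_mat ::
    "real^'n^'n \<Rightarrow> real^'n^'n \<Rightarrow> real^'n \<Rightarrow> real \<Rightarrow> real^'n^'n" where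
  "weight_mat A P k \<phi> = transpose A ** P ** A + \<phi> *\<^sub>R outer k k"

definition p_const :: "real^'n \<Rightarrow> real^'n^'n \<Rightarrow> nat \<Rightarrow> real \<Rightarrow> real \<Rightarrow> real" where
  "p_const B P r c \<phi> = c ^ r * (quad P B + \<phi>)"

definition L_fun ::
    "real^'n^'n \<Rightarrow> real^'n \<Rightarrow> real^'n^'n \<Rightarrow> real^'n^'n \<Rightarrow> real^'n \<Rightarrow> nat \<Rightarrow> real \<Rightarrow> real
     \<Rightarrow> real^'n \<Rightarrow> real" where
  "L_fun A B G P k r c \<phi> x =
     c ^ r * (row_vec A B P k \<phi> \<bullet> (mat_pow A (r - 1) *v (G *v x)))"

definition kappa_fun ::
    "real^'n^'n \<Rightarrow> real^'n \<Rightarrow> real^'n^'n \<Rightarrow> real^'n^'n \<Rightarrow> real^'n \<Rightarrow> nat \<Rightarrow> real \<Rightarrow> real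
     \<Rightarrow> real^'n \<Rightarrow> (nat \<Rightarrow> real) \<Rightarrow> real" where
  "kappa_fun A B G P k r c \<phi> x y =
     (A *v x + y 1 *\<^sub>R B) \<bullet> (P *v (G *v x))
     + (\<Sum>i=1..r-1. c ^ i * y (i + 1) *
          (row_vec A B P k \<phi> \<bullet> (mat_pow A (i - 1) *v (G *v x))))
     + (\<Sum>i=1..r. c ^ i *
          (predictor A B x y i \<bullet> (weight_mat A P k \<phi> *v (mat_pow A (i - 1) *v (G *v x)))))"

definition b_fun ::
    "real^'n^'n \<Rightarrow> real^'n \<Rightarrow> real^'n^'n \<Rightarrow> real^'n \<Rightarrow> nat \<Rightarrow> real \<Rightarrow> real
     \<Rightarrow> real^'n \<Rightarrow> (nat \<Rightarrow> real) \<Rightarrow> real" where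
  "b_fun A B P k r c \<phi> x y = c ^ r * (row_vec A B P k \<phi> \<bullet> predictor A B x y r)"

definition c_fun ::
    "real^'n^'n \<Rightarrow> real^'n \<Rightarrow> real^'n^'n \<Rightarrow> real^'n^'n \<Rightarrow> real^'n \<Rightarrow> nat \<Rightarrow> real \<Rightarrow> real
     \<Rightarrow> real \<Rightarrow> real \<Rightarrow> real^'n \<Rightarrow> (nat \<Rightarrow> real) \<Rightarrow> real" where
  "c_fun A B G P k r c \<phi> \<sigma> a x y =
     a\<^sup>2 * (\<Sum>i=0..r. c ^ i * quad P (mat_pow A i *v (G *v x)))
     + a\<^sup>2 * \<phi> * (\<Sum>i=1..r. c ^ i * (k \<bullet> (mat_pow A (i - 1) *v (G *v x)))\<^sup>2)
     + (1 - \<sigma> * c) * (\<Sum>i=1..r. c ^ (i - 1) * quad P (predictor A B x y i))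
     + c ^ r * quad (weight_mat A P k \<phi>) (predictor A B x y r)
     + (1 - \<sigma> * c) * \<phi> * (\<Sum>i=2..r. c ^ (i - 1) *
         (y i - k \<bullet> (mat_pow A (i - 1) *v x)
              - k \<bullet> (\<Sum>j=1..i-1. y j *\<^sub>R (mat_pow A (i - 1 - j) *v B)))\<^sup>2)
     - \<sigma> * quad P x
     - \<sigma> * c * \<phi> * (y 1 - k \<bullet> x)\<^sup>2"

(* The feedback K as a function of p and a and of the values of L, \<kappa>, b at (x, y).
   For a \<ge> 0 the final branch is the case p \<kappa> - b L \<le> - a L\<^sup>2; the second and third
   cases overlap only if a L = 0, and then the two expressions agree. *)
definition K_val :: "real \<Rightarrow> real \<Rightarrow> real \<Rightarrow> real \<Rightarrow> real \<Rightarrow> real" where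
  "K_val p a L \<kappa> b =
     (if \<bar>p * \<kappa> - b * L\<bar> < a * L\<^sup>2 then - inverse L * \<kappa>
      else if p * \<kappa> - b * L \<ge> a * L\<^sup>2 then - inverse p * (a * L + b)
      else inverse p * (a * L - b))"

(* The vector (y_1, ..., y_r) is an element of real^'r, the coordinates being numbered by a
   bijection e from {1..r} onto the index type: y_i = y $ e i. *)
definition coords :: "(nat \<Rightarrow> 'r) \<Rightarrow> real^'r \<Rightarrow> nat \<Rightarrow> real" where
  "coords e y = (\<lambda>i. y $ e i)"

(* x(t+1) = A x + B y_1 + d G x,  y_i(t+1) = y_(i+1) for i = 1..r,
   with y_(r+1) = u = K (x, y_1, ..., y_r) *)
definition closed_loop ::
    "real^'n^'n \<Rightarrow> real^'n \<Rightarrow> real^'n^'n \<Rightarrow> nat \<Rightarrow> (nat \<Rightarrow> 'r) \<Rightarrow>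
     (real^'n \<Rightarrow> (nat \<Rightarrow> real) \<Rightarrow> real) \<Rightarrow> real \<Rightarrow>
     (real^'n) \<times> (real^'r) \<Rightarrow> (real^'n) \<times> (real^'r)" where
  "closed_loop A B G r e K d z =
     (let x = fst z; y = coords e (snd z); u = K x y;
          y_ext = (\<lambda>i. if i = r + 1 then u else y i)
      in (A *v x + y 1 *\<^sub>R B + d *\<^sub>R (G *v x),
          (\<chi> j. y_ext (inv_into {1..r} e j + 1))))"

end

theory Submission
  imports Defs
begin

text \<open>
  Write \<open>\<xi>\<^sub>i\<close> for the predictor \<open>A\<^sup>i x + \<Sum>\<^sub>j A\<^sup>i\<^sup>-\<^sup>j B y\<^sub>j\<close>, the state reached after \<open>i\<close>
  steps of the nominal system (the one with \<open>d = 0\<close>) under the inputs \<open>y\<^sub>1, \<dots>, y\<^sub>i\<close> that wait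
  in the delay line.
  The Lyapunov function behind the theorem weighs the predicted states and the deviation of the
  stored inputs from the nominal feedback \<open>k' \<xi>\<close>,
  \<open>V = \<Sum>\<^sub>i c\<^sup>i \<xi>\<^sub>i' P \<xi>\<^sub>i + \<phi> \<Sum>\<^sub>i c\<^sup>i (y\<^sub>i - k' \<xi>\<^sub>i\<^sub>-\<^sub>1)\<^sup>2\<close>.
  One step of the system shifts the predictors, \<open>\<xi>\<^sub>i\<close> becoming \<open>\<xi>\<^sub>i\<^sub>+\<^sub>1 + d A\<^sup>i G x\<close>
  (\<open>predictor_step\<close>), so that the new value of \<open>V\<close> is an explicit quadratic polynomial
  in the new input \<open>u\<close> and in \<open>d\<close>; its coefficients are the functions of the theorem
  (\<open>lyapunov_step\<close>):
  \<open>V\<^sup>+ = \<sigma> V + p u\<^sup>2 + 2 b u + 2 d (\<kappa> + u L) + c\<^sub>d\<close>, where \<open>c\<^sub>d\<close> is the function \<open>c\<close>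
  with \<open>a\<close> replaced by \<open>d\<close>, hence \<open>c\<^sub>d \<le> c\<close> for \<open>\<bar>d\<bar> \<le> a\<close>.  The worst case over \<open>d\<close>
  is the convex function \<open>p u\<^sup>2 + 2 b u + 2 a \<bar>\<kappa> + u L\<bar> + c\<close> of \<open>u\<close>. The three branches of the
  feedback \<open>K\<close> are the possible positions of its minimiser (on the kink, or on either side of
  it), and the three inequalities of the theorem say that the minimum is nonpositive
  (\<open>feedback_worst_case_nonpos\<close>).

  So \<open>V\<^sup>+ \<le> \<sigma> V\<close> along all closed-loop trajectories. As \<open>V\<close> is a positive
  definite quadratic form in \<open>(x, y)\<close>, compactness of the unit sphere makes it comparable with
  the squared norm, and exponential stability follows (\<open>lyapunov_exp_stable\<close>).
\<close>

section \<open>Quadratic Lyapunov functions and exponential stability\<close>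

text \<open>Both constants are extrema over the unit sphere, which is compact; homogeneity carries the
  estimates to the whole space.\<close>

lemma homogeneous_pos_def_bounds:
  fixes f :: "'z::euclidean_space \<Rightarrow> real"
  assumes cont: "continuous_on UNIV f"
    and hom: "\<And>s z. f (s *\<^sub>R z) = s\<^sup>2 * f z"
    and pos: "\<And>z. z \<noteq> 0 \<Longrightarrow> 0 < f z"
  obtains m M where "0 < m" "0 < M"
    "\<And>z. m * (norm z)\<^sup>2 \<le> f z" "\<And>z. f z \<le> M * (norm z)\<^sup>2"
proof -
  let ?S = "sphere (0::'z) 1"
  have ne: "?S \<noteq> {}"
    by simp
  have contS: "continuous_on ?S f"
    using cont continuous_on_subset by blast
  obtain z1 where z1: "z1 \<in> ?S" "\<And>z. z \<in> ?S \<Longrightarrow> f z1 \<le> f z"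
    using continuous_attains_inf[OF compact_sphere ne contS] by blast
  obtain z2 where z2: "z2 \<in> ?S" "\<And>z. z \<in> ?S \<Longrightarrow> f z \<le> f z2"
    using continuous_attains_sup[OF compact_sphere ne contS] by blast
  have pos12: "0 < f z1" "0 < f z2"
    using z1(1) z2(1) by (auto intro!: pos)
  have decomp: "f z = (norm z)\<^sup>2 * f (z /\<^sub>R norm z)" and unit: "z /\<^sub>R norm z \<in> ?S"
    if "z \<noteq> 0" for z
    using that hom[of "norm z" "z /\<^sub>R norm z"] by simp_all
  have f0: "f 0 = 0"
    using hom[of 0 0] by simp
  have "f z1 * (norm z)\<^sup>2 \<le> f z" "f z \<le> f z2 * (norm z)\<^sup>2" for z
  proof -
    show "f z1 * (norm z)\<^sup>2 \<le> f z"
    proof (cases "z = 0")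
      case False
      then show ?thesis
        using decomp[OF False] mult_left_mono[OF z1(2)[OF unit[OF False]], of "(norm z)\<^sup>2"]
        by (simp add: mult.commute)
    qed (simp add: f0)
    show "f z \<le> f z2 * (norm z)\<^sup>2"
    proof (cases "z = 0")
      case False
      then show ?thesis
        using decomp[OF False] mult_left_mono[OF z2(2)[OF unit[OF False]], of "(norm z)\<^sup>2"]
        by (simp add: mult.commute)
    qed (simp add: f0)
  qed
  then show thesis
    using that pos12 by blast
qed

lemma lyapunov_exp_stable:
  fixes f :: "'z::euclidean_space \<Rightarrow> real" and g :: "'d \<Rightarrow> 'z \<Rightarrow> 'z"
  assumes cont: "continuous_on UNIV f"
    and hom: "\<And>s z. f (s *\<^sub>R z) = s\<^sup>2 * f z"
    and pos: "\<And>z. z \<noteq> 0 \<Longrightarrow> 0 < f z"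
    and equilibrium: "\<And>d. d \<in> D \<Longrightarrow> g d 0 = 0"
    and sigma: "\<sigma> < 1"
    and decay: "\<And>d z. d \<in> D \<Longrightarrow> f (g d z) \<le> \<sigma> * f z"
  shows "robustly_globally_exp_stable D g"
proof -
  obtain m M where mM: "0 < m" "0 < M"
    "\<And>z. m * (norm z)\<^sup>2 \<le> f z" "\<And>z. f z \<le> M * (norm z)\<^sup>2"
    using homogeneous_pos_def_bounds[OF cont hom pos] by metis
  have f_nonneg: "0 \<le> f z" for z
    using mM(1) mM(3)[of z] by (meson mult_nonneg_nonneg less_imp_le order_trans zero_le_power2)
  \<comment> \<open>The rate must be positive to have a logarithm, while \<open>\<sigma>\<close> may vanish.\<close>
  define \<rho> where "\<rho> = max \<sigma> (1/2)"
  have rho: "0 < \<rho>" "\<rho> < 1" "\<sigma> \<le> \<rho>"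
    using sigma by (auto simp: \<rho>_def)
  define \<omega> where "\<omega> = - ln \<rho> / 2"
  have omega: "0 < \<omega>"
    using rho by (simp add: \<omega>_def)
  have rate: "\<rho> ^ t = (exp (- \<omega> * real t))\<^sup>2" for t
  proof -
    have "(exp (- \<omega> * real t))\<^sup>2 = exp (real t * ln \<rho>)"
      by (simp add: \<omega>_def power2_eq_square flip: exp_add)
    also have "\<dots> = \<rho> ^ t"
      using rho(1) by (simp add: exp_of_nat_mult)
    finally show ?thesis ..
  qed
  have "norm (z t) \<le> sqrt (M / m) * exp (- \<omega> * real t) * norm (z 0)"
    if d: "\<forall>t. d t \<in> D" and z: "\<forall>t. z (Suc t) = g (d t) (z t)"
    for d :: "nat \<Rightarrow> 'd" and z :: "nat \<Rightarrow> 'z" and t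
  proof -
    have decay_t: "f (z t) \<le> \<rho> ^ t * f (z 0)"
    proof (induction t)
      case (Suc t)
      have "f (z (Suc t)) \<le> \<sigma> * f (z t)"
        using d z decay by simp
      also have "\<dots> \<le> \<rho> * f (z t)"
        using rho(3) f_nonneg by (rule mult_right_mono)
      also have "\<dots> \<le> \<rho> * (\<rho> ^ t * f (z 0))"
        using Suc rho(1) by simp
      finally show ?case
        by (simp add: mult.assoc)
    qed simp
    have "m * (norm (z t))\<^sup>2 \<le> f (z t)"
      by (rule mM)
    also have "\<dots> \<le> \<rho> ^ t * f (z 0)"
      by (rule decay_t)
    also have "\<dots> \<le> \<rho> ^ t * (M * (norm (z 0))\<^sup>2)"
      using mM(4) rho(1) by (intro mult_left_mono) auto
    finally have "(norm (z t))\<^sup>2 \<le> M / m * \<rho> ^ t * (norm (z 0))\<^sup>2"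
      using mM(1) by (simp add: field_simps)
    also have "\<dots> = (sqrt (M / m) * exp (- \<omega> * real t) * norm (z 0))\<^sup>2"
      using mM(1,2) by (simp only: rate power_mult_distrib) simp
    finally show ?thesis
      by (rule power2_le_imp_le) (use mM(1,2) in simp)
  qed
  moreover have "0 < sqrt (M / m)"
    using mM by simp
  ultimately show ?thesis
    unfolding robustly_globally_exp_stable_def using equilibrium omega by blast
qed

section \<open>The predictor\<close>

lemma mat_pow_0_mult: "mat_pow A 0 *v w = w"
  by (simp add: mat_pow_def)

lemma mat_pow_Suc_mult: "mat_pow A (Suc i) *v w = A *v (mat_pow A i *v w)"
  by (simp add: mat_pow_def matrix_vector_mul_assoc)

lemma predictor_0: "predictor A B x y 0 = x"
  by (simp add: predictor_def mat_pow_0_mult)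

lemma predictor_Suc:
  "predictor A B x y (Suc i) = A *v predictor A B x y i + y (Suc i) *\<^sub>R B"
proof -
  have "(\<Sum>j=1..i. y j *\<^sub>R (mat_pow A (Suc i - j) *v B))
      = A *v (\<Sum>j=1..i. y j *\<^sub>R (mat_pow A (i - j) *v B))"
    unfolding linear_sum[OF matrix_vector_mul_linear]
    by (intro sum.cong)
       (auto simp: Suc_diff_le mat_pow_Suc_mult matrix_vector_mult_scaleR)
  then show ?thesis
    by (simp add: predictor_def mat_pow_Suc_mult mat_pow_0_mult matrix_vector_right_distrib)
qed

lemma predictor_cong:
  assumes "\<And>j. 1 \<le> j \<Longrightarrow> j \<le> i \<Longrightarrow> y j = y' j"
  shows "predictor A B x y i = predictor A B x y' i"
  unfolding predictor_def using assms by (auto intro!: sum.cong)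

text \<open>The first step of the nominal system is absorbed in the predictor; a perturbation \<open>w\<close> of that
  step is then propagated by the powers of \<open>A\<close> alone, since the later inputs are the same.\<close>

lemma predictor_step:
  "predictor A B (A *v x + y 1 *\<^sub>R B + w) (\<lambda>i. y (Suc i)) i
   = predictor A B x y (Suc i) + mat_pow A i *v w"
proof (induction i)
  case 0
  then show ?case
    by (simp add: predictor_0 predictor_Suc mat_pow_0_mult)
next
  case (Suc i)
  then show ?case
    by (simp add: predictor_Suc[of A B _ _ "Suc i"] predictor_Suc[of A B "_ + _"]
        mat_pow_Suc_mult matrix_vector_right_distrib)
qed

lemma predictor_scale:
  "predictor A B (s *\<^sub>R x) (\<lambda>i. s * y i) i = s *\<^sub>R predictor A B x y i"
  by (induction i)
     (simp_all add: predictor_0 predictor_Suc matrix_vector_mult_scaleR scaleR_right_distrib)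

section \<open>Quadratic forms and the coefficient vectors\<close>

lemma pos_def_sym_inner_commute:
  assumes "pos_def_sym P"
  shows "v \<bullet> (P *v w) = w \<bullet> (P *v v)"
  using assms unfolding pos_def_sym_def
  by (metis dot_lmul_matrix inner_commute transpose_matrix_vector)

lemma quad_add:
  assumes "pos_def_sym P"
  shows "quad P (v + w) = quad P v + 2 * (v \<bullet> (P *v w)) + quad P w"
  using pos_def_sym_inner_commute[OF assms, of w v]
  by (simp add: quad_def matrix_vector_right_distrib inner_add_left inner_add_right)

lemma quad_scale: "quad P (s *\<^sub>R w) = s\<^sup>2 * quad P w"
  by (simp add: quad_def matrix_vector_mult_scaleR power2_eq_square)

lemma quad_nonneg:
  assumes "pos_def_sym P"
  shows "0 \<le> quad P w"
proof (cases "w = 0")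
  case True
  then show ?thesis
    by (simp add: quad_def)
next
  case False
  then show ?thesis
    using assms by (simp add: pos_def_sym_def less_imp_le)
qed

lemma row_vec_inner:
  "row_vec A B P k \<phi> \<bullet> w = B \<bullet> (P *v (A *v w)) - \<phi> * (k \<bullet> w)"
  by (simp add: row_vec_def inner_diff_left dot_lmul_matrix matrix_vector_mul_assoc)

lemma outer_mult: "outer u v *v w = (v \<bullet> w) *\<^sub>R u"
  by (simp add: outer_def matrix_vector_mult_def vec_eq_iff inner_vec_def sum_distrib_left
      sum_distrib_right mult_ac)

lemma weight_mat_inner:
  "v \<bullet> (weight_mat A P k \<phi> *v w) = (A *v v) \<bullet> (P *v (A *v w)) + \<phi> * (k \<bullet> v) * (k \<bullet> w)"
proof -
  have "v \<bullet> ((transpose A ** P ** A) *v w) = (A *v v) \<bullet> (P *v (A *v w))"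
    by (metis dot_lmul_matrix matrix_vector_mul_assoc transpose_matrix_vector transpose_transpose)
  then show ?thesis
    by (simp add: weight_mat_def matrix_vector_mult_add_rdistrib inner_add_right outer_mult
        scaleR_matrix_vector_assoc[symmetric] inner_commute mult_ac)
qed

section \<open>The Lyapunov function\<close>

definition lyapunov ::
    "real^'n^'n \<Rightarrow> real^'n \<Rightarrow> real^'n^'n \<Rightarrow> real^'n \<Rightarrow> nat \<Rightarrow> real \<Rightarrow> real
     \<Rightarrow> real^'n \<Rightarrow> (nat \<Rightarrow> real) \<Rightarrow> real" where
  "lyapunov A B P k r c \<phi> x y =
     (\<Sum>i=0..r. c ^ i * quad P (predictor A B x y i))
     + \<phi> * (\<Sum>i=1..r. c ^ i * (y i - k \<bullet> predictor A B x y (i - 1))\<^sup>2)"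

lemma lyapunov_cong:
  assumes "\<And>i. 1 \<le> i \<Longrightarrow> i \<le> r \<Longrightarrow> y i = y' i"
  shows "lyapunov A B P k r c \<phi> x y = lyapunov A B P k r c \<phi> x y'"
proof -
  have "predictor A B x y i = predictor A B x y' i" if "i \<le> r" for i
    using assms that by (intro predictor_cong) auto
  then show ?thesis
    using assms unfolding lyapunov_def by (auto intro!: sum.cong arg_cong2[where f = "(+)"])
qed

lemma lyapunov_scale:
  "lyapunov A B P k r c \<phi> (s *\<^sub>R x) (\<lambda>i. s * y i) = s\<^sup>2 * lyapunov A B P k r c \<phi> x y"
proof -
  have "(s * u - s * v)\<^sup>2 = s\<^sup>2 * (u - v)\<^sup>2" for u v :: real
    by (simp add: power2_eq_square algebra_simps)
  then show ?thesis
    by (simp add: lyapunov_def predictor_scale quad_scale sum_distrib_left distrib_left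
        mult.left_commute)
qed

lemma continuous_on_lyapunov:
  "continuous_on UNIV (\<lambda>z::(real^'n) \<times> (real^'r::finite).
     lyapunov A B P k r c \<phi> (fst z) (coords e (snd z)))"
  unfolding lyapunov_def predictor_def quad_def coords_def
  by (intro continuous_intros bounded_linear.continuous_on[OF matrix_vector_mul_bounded_linear])

text \<open>If all terms of the Lyapunov function vanish, then so does \<open>x\<close>, and the inputs vanish one after
  the other: once \<open>\<xi>\<^sub>i\<^sub>-\<^sub>1 = 0\<close> is known, the term of \<open>y\<^sub>i\<close> forces
  \<open>y\<^sub>i = k' \<xi>\<^sub>i\<^sub>-\<^sub>1 = 0\<close>, and then \<open>\<xi>\<^sub>i = 0\<close> as well.\<close>

lemma lyapunov_pos:
  assumes P: "pos_def_sym P" and c: "0 < c" and phi: "0 < \<phi>"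
    and nz: "x \<noteq> 0 \<or> (\<exists>i\<in>{1..r}. y i \<noteq> 0)"
  shows "0 < lyapunov A B P k r c \<phi> x y"
proof (rule ccontr)
  assume neg: "\<not> ?thesis"
  have nonneg: "0 \<le> c ^ i * quad P (predictor A B x y i)"
    "0 \<le> c ^ i * (y i - k \<bullet> predictor A B x y (i - 1))\<^sup>2" for i
    using c quad_nonneg[OF P] by simp_all
  have S1: "0 \<le> (\<Sum>i=0..r. c ^ i * quad P (predictor A B x y i))"
    and S2: "0 \<le> (\<Sum>i=1..r. c ^ i * (y i - k \<bullet> predictor A B x y (i - 1))\<^sup>2)"
    by (intro sum_nonneg nonneg)+
  have "0 \<le> \<phi> * (\<Sum>i=1..r. c ^ i * (y i - k \<bullet> predictor A B x y (i - 1))\<^sup>2)"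
    using S2 phi by simp
  with neg S1 have "(\<Sum>i=0..r. c ^ i * quad P (predictor A B x y i)) = 0"
    and "\<phi> * (\<Sum>i=1..r. c ^ i * (y i - k \<bullet> predictor A B x y (i - 1))\<^sup>2) = 0"
    unfolding lyapunov_def by linarith+
  then have states: "\<forall>i\<in>{0..r}. c ^ i * quad P (predictor A B x y i) = 0"
    and inputs: "\<forall>i\<in>{1..r}. c ^ i * (y i - k \<bullet> predictor A B x y (i - 1))\<^sup>2 = 0"
    using nonneg phi by (simp_all add: sum_nonneg_eq_0_iff)
  have xi: "predictor A B x y i = 0" if "i \<le> r" for i
  proof -
    have "quad P (predictor A B x y i) = 0"
      using states that c by force
    then show ?thesis
      using P unfolding pos_def_sym_def by force
  qed
  have "y i = 0" if "i \<in> {1..r}" for i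
  proof -
    have "y i - k \<bullet> predictor A B x y (i - 1) = 0"
      using inputs that c by force
    then show ?thesis
      using xi[of "i - 1"] that by auto
  qed
  moreover have "x = 0"
    using xi[of 0] by (simp add: predictor_0)
  ultimately show False
    using nz by blast
qed

section \<open>One step of the system\<close>

text \<open>The terms of \<open>c_fun\<close> that involve \<open>\<sigma>\<close> make up \<open>- \<sigma> V\<close>; what remains is the value of
  \<open>V\<close> after a step with \<open>u = 0\<close>, without the terms linear in \<open>d\<close>.\<close>

lemma c_fun_eq:
  assumes "1 \<le> r"
  shows "c_fun A B G P k r c \<phi> \<sigma> d x y =
     d\<^sup>2 * ((\<Sum>i=0..r. c ^ i * quad P (mat_pow A i *v (G *v x)))
            + \<phi> * (\<Sum>i=1..r. c ^ i * (k \<bullet> (mat_pow A (i - 1) *v (G *v x)))\<^sup>2))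
     + (\<Sum>i=1..r. c ^ (i - 1) * quad P (predictor A B x y i))
     + c ^ r * (quad P (A *v predictor A B x y r) + \<phi> * (k \<bullet> predictor A B x y r)\<^sup>2)
     + \<phi> * (\<Sum>i=2..r. c ^ (i - 1) * (y i - k \<bullet> predictor A B x y (i - 1))\<^sup>2)
     - \<sigma> * lyapunov A B P k r c \<phi> x y"
proof -
  let ?X = "predictor A B x y"
  have V1: "(\<Sum>i=0..r. c ^ i * quad P (?X i))
      = quad P x + c * (\<Sum>i=1..r. c ^ (i - 1) * quad P (?X i))"
  proof -
    have "(\<Sum>i=0..r. c ^ i * quad P (?X i)) = quad P x + (\<Sum>i=1..r. c ^ i * quad P (?X i))"
      by (simp add: sum.atLeast_Suc_atMost predictor_0)
    also have "(\<Sum>i=1..r. c ^ i * quad P (?X i)) = c * (\<Sum>i=1..r. c ^ (i - 1) * quad P (?X i))"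
      unfolding sum_distrib_left
      by (intro sum.cong) (auto simp: power_eq_if)
    finally show ?thesis .
  qed
  have V2: "(\<Sum>i=1..r. c ^ i * (y i - k \<bullet> ?X (i - 1))\<^sup>2)
      = c * (y 1 - k \<bullet> x)\<^sup>2 + c * (\<Sum>i=2..r. c ^ (i - 1) * (y i - k \<bullet> ?X (i - 1))\<^sup>2)"
  proof -
    have "(\<Sum>i=1..r. c ^ i * (y i - k \<bullet> ?X (i - 1))\<^sup>2)
        = c * (y 1 - k \<bullet> x)\<^sup>2 + (\<Sum>i=2..r. c ^ i * (y i - k \<bullet> ?X (i - 1))\<^sup>2)"
      using assms by (simp add: sum.atLeast_Suc_atMost predictor_0 numeral_2_eq_2)
    also have "(\<Sum>i=2..r. c ^ i * (y i - k \<bullet> ?X (i - 1))\<^sup>2)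
        = c * (\<Sum>i=2..r. c ^ (i - 1) * (y i - k \<bullet> ?X (i - 1))\<^sup>2)"
      unfolding sum_distrib_left
      by (intro sum.cong) (auto simp: power_eq_if)
    finally show ?thesis .
  qed
  have deviation: "y i - k \<bullet> (mat_pow A (i - 1) *v x)
      - k \<bullet> (\<Sum>j=1..i-1. y j *\<^sub>R (mat_pow A (i - 1 - j) *v B)) = y i - k \<bullet> ?X (i - 1)" for i
    by (simp add: predictor_def inner_add_right)
  have weight: "quad (weight_mat A P k \<phi>) (?X r) = quad P (A *v ?X r) + \<phi> * (k \<bullet> ?X r)\<^sup>2"
    unfolding quad_def weight_mat_inner by (simp add: power2_eq_square)
  show ?thesis
    unfolding c_fun_def lyapunov_def V1 V2 deviation weight
    by (simp add: algebra_simps)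
qed

lemma c_fun_mono:
  assumes P: "pos_def_sym P" and r: "1 \<le> r" and c: "0 < c" and phi: "0 < \<phi>" and d: "\<bar>d\<bar> \<le> a"
  shows "c_fun A B G P k r c \<phi> \<sigma> d x y \<le> c_fun A B G P k r c \<phi> \<sigma> a x y"
proof -
  let ?S = "(\<Sum>i=0..r. c ^ i * quad P (mat_pow A i *v (G *v x)))
            + \<phi> * (\<Sum>i=1..r. c ^ i * (k \<bullet> (mat_pow A (i - 1) *v (G *v x)))\<^sup>2)"
  have "0 \<le> ?S"
    using c phi quad_nonneg[OF P] by (intro add_nonneg_nonneg mult_nonneg_nonneg sum_nonneg) auto
  moreover have "d\<^sup>2 \<le> a\<^sup>2"
    using d by (metis abs_ge_zero order_trans abs_le_square_iff abs_of_nonneg)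
  ultimately have "d\<^sup>2 * ?S \<le> a\<^sup>2 * ?S"
    by (rule mult_right_mono[rotated])
  then show ?thesis
    unfolding c_fun_eq[OF r] by linarith
qed

text \<open>Half the coefficient of \<open>d\<close> in the Lyapunov function after one step. The new input
  \<open>u = y\<^sub>r\<^sub>+\<^sub>1\<close> enters only through the last terms of both sums, and its coefficient there is
  \<open>L\<close>.\<close>

lemma kappa_fun_plus_L_fun:
  assumes "1 \<le> r"
  shows "kappa_fun A B G P k r c \<phi> x y + y (Suc r) * L_fun A B G P k r c \<phi> x
    = (\<Sum>i=0..r. c ^ i * (predictor A B x y (Suc i) \<bullet> (P *v (mat_pow A i *v (G *v x)))))
      - \<phi> * (\<Sum>i=1..r. c ^ i * ((y (Suc i) - k \<bullet> predictor A B x y i)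
                              * (k \<bullet> (mat_pow A (i - 1) *v (G *v x)))))"
proof -
  let ?X = "predictor A B x y"
  let ?W = "\<lambda>i. mat_pow A i *v (G *v x)"
  let ?row = "\<lambda>i. c ^ i * y (Suc i) * (row_vec A B P k \<phi> \<bullet> ?W (i - 1))"
  have rows: "(\<Sum>i=1..r-1. c ^ i * y (i + 1) * (row_vec A B P k \<phi> \<bullet> ?W (i - 1)))
      + y (Suc r) * L_fun A B G P k r c \<phi> x = (\<Sum>i=1..r. ?row i)"
  proof -
    obtain s where s: "r = Suc s"
      using assms by (cases r) auto
    show ?thesis
      by (simp add: L_fun_def s)
  qed
  have "kappa_fun A B G P k r c \<phi> x y + y (Suc r) * L_fun A B G P k r c \<phi> x
      = ?X (Suc 0) \<bullet> (P *v ?W 0)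
        + ((\<Sum>i=1..r. ?row i) + (\<Sum>i=1..r. c ^ i * (?X i \<bullet> (weight_mat A P k \<phi> *v ?W (i - 1)))))"
    unfolding rows[symmetric]
    by (simp add: kappa_fun_def predictor_Suc predictor_0 mat_pow_0_mult)
  also have "(\<Sum>i=1..r. ?row i) + (\<Sum>i=1..r. c ^ i * (?X i \<bullet> (weight_mat A P k \<phi> *v ?W (i - 1))))
      = (\<Sum>i=1..r. c ^ i * (?X (Suc i) \<bullet> (P *v ?W i)))
        - \<phi> * (\<Sum>i=1..r. c ^ i * ((y (Suc i) - k \<bullet> ?X i) * (k \<bullet> ?W (i - 1))))"
    unfolding sum_distrib_left sum.distrib[symmetric] sum_subtractf[symmetric]
  proof (intro sum.cong refl)
    fix i
    assume "i \<in> {1..r}"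
    then obtain s where s: "i = Suc s"
      by (cases i) auto
    have "?X (Suc i) \<bullet> (P *v ?W i)
        = (A *v ?X i) \<bullet> (P *v (A *v ?W s)) + y (Suc i) * (B \<bullet> (P *v (A *v ?W s)))"
      by (simp add: predictor_Suc[of A B x y "Suc s"] s mat_pow_Suc_mult inner_add_left)
    then show "?row i + c ^ i * (?X i \<bullet> (weight_mat A P k \<phi> *v ?W (i - 1)))
        = c ^ i * (?X (Suc i) \<bullet> (P *v ?W i))
          - \<phi> * (c ^ i * ((y (Suc i) - k \<bullet> ?X i) * (k \<bullet> ?W (i - 1))))"
      by (simp add: s row_vec_inner weight_mat_inner) (simp add: algebra_simps)
  qed
  finally show ?thesis
    by (simp add: sum.atLeast_Suc_atMost[of 0])
qed

text \<open>The sequence \<open>y\<close> is taken long enough to contain the new input \<open>u\<close> as \<open>y\<^sub>r\<^sub>+\<^sub>1\<close>, so that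
  the update of the delay line is the shift.  The value of \<open>d\<close> in the last coefficient makes this an
  identity; the bound \<open>a\<close> enters only afterwards.\<close>

lemma lyapunov_step:
  fixes y :: "nat \<Rightarrow> real"
  assumes P: "pos_def_sym P" and r: "1 \<le> r"
  defines "u \<equiv> y (Suc r)"
  shows "lyapunov A B P k r c \<phi> (A *v x + y 1 *\<^sub>R B + d *\<^sub>R (G *v x)) (\<lambda>i. y (Suc i))
    = \<sigma> * lyapunov A B P k r c \<phi> x y
      + p_const B P r c \<phi> * u\<^sup>2 + 2 * b_fun A B P k r c \<phi> x y * u
      + 2 * d * (kappa_fun A B G P k r c \<phi> x y + u * L_fun A B G P k r c \<phi> x)
      + c_fun A B G P k r c \<phi> \<sigma> d x y"
proof -
  let ?X = "predictor A B x y"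
  let ?W = "\<lambda>i. mat_pow A i *v (G *v x)"
  let ?dev = "\<lambda>i. y (Suc i) - k \<bullet> ?X i"
  have step: "predictor A B (A *v x + y 1 *\<^sub>R B + d *\<^sub>R (G *v x)) (\<lambda>i. y (Suc i)) i
      = ?X (Suc i) + d *\<^sub>R ?W i" for i
    by (simp only: predictor_step matrix_vector_mult_scaleR)
  have states: "(\<Sum>i=0..r. c ^ i * quad P (?X (Suc i) + d *\<^sub>R ?W i))
      = (\<Sum>i=0..r. c ^ i * quad P (?X (Suc i)))
        + 2 * d * (\<Sum>i=0..r. c ^ i * (?X (Suc i) \<bullet> (P *v ?W i)))
        + d\<^sup>2 * (\<Sum>i=0..r. c ^ i * quad P (?W i))"
    unfolding sum_distrib_left sum.distrib[symmetric]
    by (intro sum.cong refl)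
       (simp add: quad_add[OF P] quad_scale matrix_vector_mult_scaleR algebra_simps)
  have inputs: "(\<Sum>i=1..r. c ^ i * (y (Suc i) - k \<bullet> (?X (Suc (i - 1)) + d *\<^sub>R ?W (i - 1)))\<^sup>2)
      = (\<Sum>i=1..r. c ^ i * (?dev i)\<^sup>2)
        - 2 * d * (\<Sum>i=1..r. c ^ i * (?dev i * (k \<bullet> ?W (i - 1))))
        + d\<^sup>2 * (\<Sum>i=1..r. c ^ i * (k \<bullet> ?W (i - 1))\<^sup>2)"
    unfolding sum_distrib_left sum.distrib[symmetric] sum_subtractf[symmetric]
    by (intro sum.cong refl)
       (auto simp: inner_add_right power2_eq_square algebra_simps)
  obtain s where s: "r = Suc s"
    using r by (cases r) auto
  have last_state: "(\<Sum>i=0..r. c ^ i * quad P (?X (Suc i)))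
      = (\<Sum>i=1..r. c ^ (i - 1) * quad P (?X i))
        + c ^ r * (quad P (A *v ?X r) + 2 * u * (B \<bullet> (P *v (A *v ?X r))) + u\<^sup>2 * quad P B)"
  proof -
    have "(\<Sum>i=1..r. c ^ (i - 1) * quad P (?X i)) = (\<Sum>i=0..s. c ^ i * quad P (?X (Suc i)))"
      using sum.shift_bounds_cl_Suc_ivl[of "\<lambda>i. c ^ (i - 1) * quad P (?X i)" 0 s] by (simp add: s)
    moreover have "quad P (?X (Suc r))
        = quad P (A *v ?X r) + 2 * u * (B \<bullet> (P *v (A *v ?X r))) + u\<^sup>2 * quad P B"
      using pos_def_sym_inner_commute[OF P, of "A *v ?X r" B]
      by (simp add: predictor_Suc quad_add[OF P] quad_scale matrix_vector_mult_scaleR u_def)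
    ultimately show ?thesis
      by (simp add: s)
  qed
  have last_input: "(\<Sum>i=1..r. c ^ i * (?dev i)\<^sup>2)
      = (\<Sum>i=2..r. c ^ (i - 1) * (y i - k \<bullet> ?X (i - 1))\<^sup>2) + c ^ r * (u - k \<bullet> ?X r)\<^sup>2"
  proof -
    have "(\<Sum>i=2..r. c ^ (i - 1) * (y i - k \<bullet> ?X (i - 1))\<^sup>2) = (\<Sum>i=1..s. c ^ i * (?dev i)\<^sup>2)"
      using sum.shift_bounds_cl_Suc_ivl[of "\<lambda>i. c ^ (i - 1) * (y i - k \<bullet> ?X (i - 1))\<^sup>2" 1 s]
      by (simp add: s numeral_2_eq_2)
    then show ?thesis
      by (simp add: s u_def)
  qed
  have b: "b_fun A B P k r c \<phi> x y
      = c ^ r * (B \<bullet> (P *v (A *v ?X r)) - \<phi> * (k \<bullet> ?X r))"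
    by (simp add: b_fun_def row_vec_inner)
  show ?thesis
    unfolding lyapunov_def[of A B P k r c \<phi> "_ + _"] step states inputs last_state last_input
      c_fun_eq[OF r] kappa_fun_plus_L_fun[OF r, of A B G P k c \<phi> x y, folded u_def]
      p_const_def b
    by (simp add: algebra_simps power2_eq_square)
qed

section \<open>The feedback\<close>

text \<open>In the first branch \<open>u = - \<kappa> / L\<close> is the kink, where \<open>d\<close> has no influence.  In the other two,
  \<open>u\<close> is the vertex of the parabola with \<open>d = a\<close> or \<open>d = - a\<close>, and the condition of the
  branch says that this sign of \<open>d\<close> is the worst one at \<open>u\<close>.\<close>

lemma feedback_worst_case_nonpos:
  fixes p a L \<kappa> b C d :: real
  assumes p: "0 < p" and d: "\<bar>d\<bar> \<le> a"
    and kink: "\<bar>p * \<kappa> - b * L\<bar> < a * L\<^sup>2 \<Longrightarrow> p * (\<kappa> / L)\<^sup>2 - 2 * b * (\<kappa> / L) + C \<le> 0"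
    and right: "a * L\<^sup>2 \<le> p * \<kappa> - b * L \<Longrightarrow> - inverse p * (a * L + b)\<^sup>2 + C + 2 * a * \<kappa> \<le> 0"
    and left: "p * \<kappa> - b * L \<le> - a * L\<^sup>2 \<Longrightarrow> - inverse p * (a * L - b)\<^sup>2 + C - 2 * a * \<kappa> \<le> 0"
  defines "u \<equiv> K_val p a L \<kappa> b"
  shows "p * u\<^sup>2 + 2 * b * u + 2 * d * (\<kappa> + u * L) + C \<le> 0"
proof -
  consider "\<bar>p * \<kappa> - b * L\<bar> < a * L\<^sup>2"
    | "\<not> \<bar>p * \<kappa> - b * L\<bar> < a * L\<^sup>2" "a * L\<^sup>2 \<le> p * \<kappa> - b * L"
    | "\<not> \<bar>p * \<kappa> - b * L\<bar> < a * L\<^sup>2" "\<not> a * L\<^sup>2 \<le> p * \<kappa> - b * L"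
    by blast
  then show ?thesis
  proof cases
    case 1
    then have "L \<noteq> 0"
      by auto
    moreover have u: "u = - (\<kappa> / L)"
      using 1 by (simp add: u_def K_val_def field_simps)
    ultimately have "\<kappa> + u * L = 0"
      by simp
    then show ?thesis
      using kink[OF 1] by (simp add: u)
  next
    case 2
    have "u = - inverse p * (a * L + b)"
      using 2 by (simp add: u_def K_val_def)
    then have u: "p * u = - (a * L + b)"
      using p by (simp add: field_simps)
    have "p * (\<kappa> + u * L) = p * \<kappa> + (p * u) * L"
      by (simp add: algebra_simps)
    also have "\<dots> \<ge> 0"
      unfolding u using 2(2) by (simp add: algebra_simps power2_eq_square)
    finally have "0 \<le> \<kappa> + u * L"
      using p by (simp add: zero_le_mult_iff)
    then have worst: "d * (\<kappa> + u * L) \<le> a * (\<kappa> + u * L)"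
      using d by (intro mult_right_mono) auto
    have "inverse p * (a * L + b)\<^sup>2 = inverse p * (p * u)\<^sup>2"
      by (simp add: u power2_eq_square algebra_simps)
    also have "\<dots> = p * u\<^sup>2"
      using p by (simp add: power2_eq_square)
    finally have "- (p * u\<^sup>2) + C + 2 * a * \<kappa> \<le> 0"
      using right[OF 2(2)] by simp
    moreover have "p * u\<^sup>2 = - (a * L + b) * u"
      by (metis mult.assoc power2_eq_square u)
    ultimately show ?thesis
      using worst by (simp add: algebra_simps)
  next
    case 3
    then have le: "p * \<kappa> - b * L \<le> - a * L\<^sup>2"
      by auto
    have "u = inverse p * (a * L - b)"
      unfolding u_def K_val_def if_not_P[OF 3(1)] if_not_P[OF 3(2)] ..
    then have u: "p * u = a * L - b"
      using p by simp
    have "p * (\<kappa> + u * L) = p * \<kappa> + (p * u) * L"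
      by (simp add: algebra_simps)
    also have "\<dots> \<le> 0"
      unfolding u using le by (simp add: algebra_simps power2_eq_square)
    finally have "\<kappa> + u * L \<le> 0"
      using p by (simp add: mult_le_0_iff)
    then have worst: "d * (\<kappa> + u * L) \<le> - a * (\<kappa> + u * L)"
      using d by (intro mult_right_mono_neg) auto
    have "inverse p * (a * L - b)\<^sup>2 = p * u\<^sup>2"
      using p by (simp add: power2_eq_square flip: u)
    then have "- (p * u\<^sup>2) + C - 2 * a * \<kappa> \<le> 0"
      using left[OF le] by simp
    moreover have "p * u\<^sup>2 = (a * L - b) * u"
      by (metis mult.assoc power2_eq_square u)
    ultimately show ?thesis
      using worst by (simp add: algebra_simps)
  qed
qed

section \<open>The closed loop\<close>

lemma coords_closed_loop:
  assumes "bij_betw e {1..r} (UNIV :: 'r::finite set)" and "i \<in> {1..r}"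
  shows "coords e (snd (closed_loop A B G r e K d z)) i
    = ((coords e (snd z))(Suc r := K (fst z) (coords e (snd z)))) (Suc i)"
proof -
  have "inv_into {1..r} e (e i) = i"
    using assms by (intro inv_into_f_f) (auto simp: bij_betw_def)
  then show ?thesis
    by (simp add: closed_loop_def Let_def coords_def)
qed

lemma fst_closed_loop:
  "fst (closed_loop A B G r e K d z)
   = A *v fst z + coords e (snd z) 1 *\<^sub>R B + d *\<^sub>R (G *v fst z)"
  by (simp add: closed_loop_def Let_def)

lemma closed_loop_0:
  assumes "K 0 (\<lambda>_. 0) = 0"
  shows "closed_loop A B G r e K d 0 = 0"
  using assms
  by (simp add: closed_loop_def Let_def coords_def zero_prod_def vec_eq_iff)

theorem theorem3p2:
  fixes A G P :: "real^'n^'n" and B k :: "real^'n"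
    and a lam c \<phi> \<sigma> p :: real
    and r :: nat and e :: "nat \<Rightarrow> 'r::finite"
    and L :: "real^'n \<Rightarrow> real"
    and \<kappa> b cf K :: "real^'n \<Rightarrow> (nat \<Rightarrow> real) \<Rightarrow> real"
  assumes "0 \<le> a"
    and "0 \<le> lam" and "lam < 1"
    and "pos_def_sym P"
    and "\<And>x. x \<bullet> ((transpose (A + outer B k) ** P ** (A + outer B k)) *v x) \<le> lam * quad P x"
    and "2 \<le> r"
    and "bij_betw e {1..r} (UNIV :: 'r set)"
    and "1 < c" and "0 < \<phi>" and "0 \<le> \<sigma>" and "\<sigma> < 1"
    and "p = p_const B P r c \<phi>"
    and "L = L_fun A B G P k r c \<phi>"
    and "\<kappa> = kappa_fun A B G P k r c \<phi>"
    and "b = b_fun A B P k r c \<phi>"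
    and "cf = c_fun A B G P k r c \<phi> \<sigma> a"
    and "K = (\<lambda>x y. K_val p a (L x) (\<kappa> x y) (b x y))"
    and "\<And>x (v :: real^'r). let y = coords e v in
           \<bar>p * \<kappa> x y - b x y * L x\<bar> < a * (L x)\<^sup>2 \<longrightarrow>
           p * (\<kappa> x y / L x)\<^sup>2 - 2 * b x y * (\<kappa> x y / L x) + cf x y \<le> 0"
    and "\<And>x (v :: real^'r). let y = coords e v in
           p * \<kappa> x y - b x y * L x \<ge> a * (L x)\<^sup>2 \<longrightarrow>
           - inverse p * (a * L x + b x y)\<^sup>2 + cf x y + 2 * a * \<kappa> x y \<le> 0"
    and "\<And>x (v :: real^'r). let y = coords e v in
           p * \<kappa> x y - b x y * L x \<le> - a * (L x)\<^sup>2 \<longrightarrow>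
           - inverse p * (a * L x - b x y)\<^sup>2 + cf x y - 2 * a * \<kappa> x y \<le> 0"
  shows "robustly_globally_exp_stable {-a..a} (closed_loop A B G r e K)"
proof -
  note P = \<open>pos_def_sym P\<close> and phi = \<open>0 < \<phi>\<close> and bij = \<open>bij_betw e {1..r} (UNIV :: 'r set)\<close>
  have r: "1 \<le> r" and c: "0 < c"
    using assms by auto
  have p: "0 < p"
    using c phi quad_nonneg[OF P, of B] by (simp add: \<open>p = _\<close> p_const_def add_nonneg_pos)
  let ?V = "lyapunov A B P k r c \<phi>"
  have pos: "0 < ?V (fst z) (coords e (snd z))" if "z \<noteq> 0" for z :: "(real^'n) \<times> (real^'r)"
  proof (rule lyapunov_pos[OF P c phi])
    have "\<exists>i\<in>{1..r}. coords e (snd z) i \<noteq> 0" if nz: "snd z \<noteq> 0"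
    proof -
      obtain j where "snd z $ j \<noteq> 0"
        using nz by (auto simp: vec_eq_iff)
      moreover obtain i where "i \<in> {1..r}" "j = e i"
        using bij unfolding bij_betw_def by blast
      ultimately show ?thesis
        by (auto simp: coords_def)
    qed
    then show "fst z \<noteq> 0 \<or> (\<exists>i\<in>{1..r}. coords e (snd z) i \<noteq> 0)"
      using that by (auto simp: prod_eq_iff)
  qed
  have decay: "?V (fst (closed_loop A B G r e K d z)) (coords e (snd (closed_loop A B G r e K d z)))
      \<le> \<sigma> * ?V (fst z) (coords e (snd z))" if "d \<in> {-a..a}" for d and z :: "(real^'n) \<times> (real^'r)"
  proof -
    let ?x = "fst z"
    let ?y = "coords e (snd z)"
    define u where "u = K ?x ?y"
    \<comment> \<open>the delay line extended by the new input\<close>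
    define y' where "y' = ?y(Suc r := u)"
    have y': "y' i = ?y i" if "i \<le> r" for i
      using that by (simp add: y'_def)
    have y'_Suc: "y' (Suc i) = ?y (Suc i)" if "i \<le> r - Suc 0" for i
      using that r by (intro y') simp
    have y'_u: "y' (Suc r) = u"
      by (simp add: y'_def)
    have xi: "predictor A B ?x y' i = predictor A B ?x ?y i" if "i \<le> r" for i
      using that by (intro predictor_cong) (simp add: y')
    have V: "?V ?x y' = ?V ?x ?y"
      by (intro lyapunov_cong) (simp add: y')
    have \<kappa>: "kappa_fun A B G P k r c \<phi> ?x y' = \<kappa> ?x ?y"
      unfolding \<open>\<kappa> = _\<close> kappa_fun_def
      using r by (simp add: xi y' y'_Suc cong: sum.cong_simp)
    have b: "b_fun A B P k r c \<phi> ?x y' = b ?x ?y"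
      by (simp add: \<open>b = _\<close> b_fun_def xi)
    have C: "c_fun A B G P k r c \<phi> \<sigma> a ?x y' = cf ?x ?y"
      unfolding \<open>cf = _\<close> c_fun_eq[OF r] V
      by (simp add: xi xi[OF order.trans[OF diff_le_self]] y' cong: sum.cong_simp)
    have d: "\<bar>d\<bar> \<le> a"
      using that by auto
    have "?V (fst (closed_loop A B G r e K d z)) (coords e (snd (closed_loop A B G r e K d z)))
        = ?V (A *v ?x + y' 1 *\<^sub>R B + d *\<^sub>R (G *v ?x)) (\<lambda>i. y' (Suc i))"
      using r unfolding fst_closed_loop y'[OF r]
      by (intro lyapunov_cong) (simp add: coords_closed_loop[OF bij] y'_def u_def)
    also have "\<dots> = \<sigma> * ?V ?x ?y + p * u\<^sup>2 + 2 * b ?x ?y * u + 2 * d * (\<kappa> ?x ?y + u * L ?x)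
        + c_fun A B G P k r c \<phi> \<sigma> d ?x y'"
      unfolding lyapunov_step[OF P r, where \<sigma> = \<sigma>] V \<kappa> b y'_u \<open>p = _\<close> \<open>L = _\<close> ..
    also have "\<dots> \<le> \<sigma> * ?V ?x ?y
        + (p * u\<^sup>2 + 2 * b ?x ?y * u + 2 * d * (\<kappa> ?x ?y + u * L ?x) + cf ?x ?y)"
      using c_fun_mono[OF P r c phi d, of A B G k \<sigma> ?x y'] by (simp add: C)
    finally have step: "?V (fst (closed_loop A B G r e K d z)) (coords e (snd (closed_loop A B G r e K d z)))
        \<le> \<sigma> * ?V ?x ?y
          + (p * u\<^sup>2 + 2 * b ?x ?y * u + 2 * d * (\<kappa> ?x ?y + u * L ?x) + cf ?x ?y)" .
    have "p * u\<^sup>2 + 2 * b ?x ?y * u + 2 * d * (\<kappa> ?x ?y + u * L ?x) + cf ?x ?y \<le> 0"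
      unfolding u_def \<open>K = _\<close>
      using assms(18-20)[of "snd z" ?x, unfolded Let_def]
      by (intro feedback_worst_case_nonpos[OF p d]) blast+
    with step show ?thesis
      by linarith
  qed
  have "K 0 (\<lambda>_. 0) = 0"
  proof -
    have "predictor A B 0 (\<lambda>_. 0) i = 0" for i
      by (simp add: predictor_def)
    then have "L 0 = 0" "\<kappa> 0 (\<lambda>_. 0) = 0" "b 0 (\<lambda>_. 0) = 0"
      by (simp_all add: \<open>L = _\<close> \<open>\<kappa> = _\<close> \<open>b = _\<close> L_fun_def kappa_fun_def b_fun_def)
    then show ?thesis
      by (simp add: \<open>K = _\<close> K_val_def)
  qed
  then have equilibrium: "closed_loop A B G r e K d 0 = 0" if "d \<in> {-a..a}" for d
    by (rule closed_loop_0)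
  have hom: "?V (fst (s *\<^sub>R z)) (coords e (snd (s *\<^sub>R z))) = s\<^sup>2 * ?V (fst z) (coords e (snd z))"
    for s and z :: "(real^'n) \<times> (real^'r)"
    using lyapunov_scale[of A B P k r c \<phi> s "fst z" "coords e (snd z)"]
    by (simp add: coords_def)
  show ?thesis
    by (rule lyapunov_exp_stable[where f = "\<lambda>z. ?V (fst z) (coords e (snd z))" and \<sigma> = \<sigma>])
       (fact continuous_on_lyapunov hom pos equilibrium \<open>\<sigma> < 1\<close> decay)+
qed

end
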